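(* Let $N\ge 1$ and let $\mathcal{I}$ be a nonempty finite multiset of permutations in $\mathfrak{S}_N$, with strike projection $\sigma:\mathcal{I}\to\mathcal{P}_N$. The following are equivalent: (1) $\mathcal{I}$ defines a strategy-indifferent game of best choice. (2) $\mathcal{I}$ has a maximal chain partition. (3) $|\sigma^{-1}(p)|=\sum_{q\text{ covers }p}|\sigma^{-1}(q)|$ for all non-maximal $p\in\mathcal{P}_N$, where the sum is over all $q\in\mathcal{P}_N$ that cover $p$.
   Context: $\mathfrak{S}_N$ is the set of permutations of $\{1,\dots,N\}$ in one-line notation. The flattening of a sequence of $i$ distinct integers is the unique permutation of $\{1,\dots,i\}$ with the same relative order. For a permutation $\pi$, $\pi|_{[i]}$ denotes the flattening of $\pi_1,\dots,\pi_i$. Game of best choice defined by a multiset $\mathcal{I}$ of elements of $\mathfrak{S}_N$: $\pi\in\mathcal{I}$ is chosen uniformly at random (each element weighted by its multiplicity; $|\mathcal{I}|$ is the sum of the multiplicities), and $\pi|_{[1]},\pi|_{[2]},\dots$ are presented sequentially to the player, who may stop at one position. The player wins if they stop at position $i$ with $\pi_i=N$, and loses otherwise. A strategy is given by a strike set $A$ of prefixes: the player stops at the first $i$ for which $\pi|_{[i]}\in A$ (and loses if there is no such $i$). An entry $\pi_j$ is a left-to-right maximum if $\pi_i<\pi_j$ for all $i<j$. A permutation in $\bigcup_{i=1}^N\mathfrak{S}_i$ is an eligible prefix if its last entry is a left-to-right maximum. The prefix tree $\mathcal{P}_N$ is the set of all eligible prefixes in $\bigcup_{i=1}^N\mathfrak{S}_i$,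 partially ordered by containment: $q$ contains $p$ if $q|_{[i]}=p$, where $i$ is the size of $p$. As usual, $q$ covers $p$ if $q\neq p$ contains $p$ and no other element lies strictly between them. A maximal antichain in $\mathcal{P}_N$ is a subset $A\subseteq\mathcal{P}_N$ with no two distinct elements comparable and such that every element of $\mathcal{P}_N$ contains or is contained in some element of $A$. $\mathcal{I}$ is strategy-indifferent if every strike set that is a maximal antichain in $\mathcal{P}_N$ has the same probability of winning the game defined by $\mathcal{I}$. The strike projection $\sigma:\mathcal{I}\to\mathcal{P}_N$ sends $\pi$ to $\pi|_{[i]}$, where $i$ is the position with $\pi_i=N$. $|\sigma^{-1}(p)|$ is counted with multiplicity. A subset $J\subseteq\mathfrak{S}_N$ is a maximal saturated chain if $\sigma$ restricts to a bijection from $J$ onto a maximal saturated chain of $\mathcal{P}_N$ (a totally ordered subset to which no element can be added while remaining totally ordered). $\mathcal{I}$ has a maximal chain partition if it can be partitioned, with multiplicity, into subsets $J_1,\dots,J_k$ each of which is a maximal saturated chain; that is, for each $\pi\in\mathfrak{S}_N$ the number of indices $j$ with $\pi\in J_j$ equals the multiplicity of $\pi$ in $\mathcal{I}$ (the same subset may occur for several indices). *)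

theory Defs
  imports "HOL-Probability.Probability" "HOL-Combinatorics.Multiset_Permutations"
begin

text \<open>
  A permutation of \<open>{1..n}\<close> in one-line notation is a list in \<^term>\<open>permutations_of_set {1..n}\<close>.
  List positions are counted from 0, so the entry written $\pi_{i+1}$ on paper is \<open>\<pi> ! i\<close>,
  and it is revealed together with the prefix of size \<open>Suc i\<close>.
\<close>

abbreviation perms :: "nat \<Rightarrow> nat list set" where
  "perms n \<equiv> permutations_of_set {1..n}"

definition flattening :: "nat list \<Rightarrow> nat list" where
  "flattening xs = (THE ys. ys \<in> perms (length xs) \<and>
     (\<forall>a<length xs. \<forall>b<length xs. ys ! a < ys ! b \<longleftrightarrow> xs ! a < xs ! b))"

definition restr :: "nat \<Rightarrow> nat list \<Rightarrow> nat list" where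
  "restr i \<pi> = flattening (take i \<pi>)"

definition left_to_right_maximum :: "nat list \<Rightarrow> nat \<Rightarrow> bool" where
  "left_to_right_maximum \<pi> j \<longleftrightarrow> j < length \<pi> \<and> (\<forall>i<j. \<pi> ! i < \<pi> ! j)"

definition prefix_tree :: "nat \<Rightarrow> nat list set" where
  "prefix_tree N = {p \<in> (\<Union>i\<in>{1..N}. perms i). left_to_right_maximum p (length p - 1)}"

definition contained_in :: "nat list \<Rightarrow> nat list \<Rightarrow> bool" where
  "contained_in p q \<longleftrightarrow> length p \<le> length q \<and> restr (length p) q = p"

definition covers :: "nat \<Rightarrow> nat list \<Rightarrow> nat list \<Rightarrow> bool" where
  "covers N q p \<longleftrightarrow> p \<in> prefix_tree N \<and> q \<in> prefix_tree N \<and> q \<noteq> p \<and> contained_in p q \<and>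
     \<not> (\<exists>r\<in>prefix_tree N. r \<noteq> p \<and> r \<noteq> q \<and> contained_in p r \<and> contained_in r q)"

definition maximal_prefix :: "nat \<Rightarrow> nat list \<Rightarrow> bool" where
  "maximal_prefix N p \<longleftrightarrow> p \<in> prefix_tree N \<and> (\<forall>q\<in>prefix_tree N. contained_in p q \<longrightarrow> q = p)"

definition maximal_antichain :: "nat \<Rightarrow> nat list set \<Rightarrow> bool" where
  "maximal_antichain N A \<longleftrightarrow> A \<subseteq> prefix_tree N \<and>
     (\<forall>p\<in>A. \<forall>q\<in>A. contained_in p q \<longrightarrow> p = q) \<and>
     (\<forall>p\<in>prefix_tree N. \<exists>a\<in>A. contained_in a p \<or> contained_in p a)"

definition maximal_chain :: "nat \<Rightarrow> nat list set \<Rightarrow> bool" where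
  "maximal_chain N C \<longleftrightarrow> pred_on.maxchain (prefix_tree N) contained_in C"

definition stops_at :: "nat list set \<Rightarrow> nat list \<Rightarrow> nat \<Rightarrow> bool" where
  "stops_at A \<pi> i \<longleftrightarrow> i < length \<pi> \<and> restr (Suc i) \<pi> \<in> A \<and> (\<forall>j<i. restr (Suc j) \<pi> \<notin> A)"

definition wins :: "nat \<Rightarrow> nat list set \<Rightarrow> nat list \<Rightarrow> bool" where
  "wins N A \<pi> \<longleftrightarrow> (\<exists>i. stops_at A \<pi> i \<and> \<pi> ! i = N)"

definition win_probability :: "nat \<Rightarrow> nat list multiset \<Rightarrow> nat list set \<Rightarrow> real" where
  "win_probability N I A = measure_pmf.prob (pmf_of_multiset I) {\<pi>. wins N A \<pi>}"

definition strategy_indifferent :: "nat \<Rightarrow> nat list multiset \<Rightarrow> bool" where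
  "strategy_indifferent N I \<longleftrightarrow>
     (\<forall>A B. maximal_antichain N A \<longrightarrow> maximal_antichain N B \<longrightarrow>
        win_probability N I A = win_probability N I B)"

text \<open>The strike projection does not depend on the multiset, so it is defined on all permutations.\<close>

definition strike_projection :: "nat \<Rightarrow> nat list \<Rightarrow> nat list" where
  "strike_projection N \<pi> = restr (Suc (THE i. i < length \<pi> \<and> \<pi> ! i = N)) \<pi>"

definition fiber_size :: "nat \<Rightarrow> nat list multiset \<Rightarrow> nat list \<Rightarrow> nat" where
  "fiber_size N I p = size {#\<pi> \<in># I. strike_projection N \<pi> = p#}"

definition maximal_saturated_chain :: "nat \<Rightarrow> nat list set \<Rightarrow> bool" where
  "maximal_saturated_chain N J \<longleftrightarrow> J \<subseteq> perms N \<and>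
     (\<exists>C. maximal_chain N C \<and> bij_betw (strike_projection N) J C)"

text \<open>The parts $J_1,\dots,J_k$ form a list, so that the same subset may be used several times.\<close>

definition has_maximal_chain_partition :: "nat \<Rightarrow> nat list multiset \<Rightarrow> bool" where
  "has_maximal_chain_partition N I \<longleftrightarrow>
     (\<exists>Js. (\<forall>J\<in>set Js. maximal_saturated_chain N J) \<and>
        (\<forall>\<pi>\<in>perms N. card {j. j < length Js \<and> \<pi> \<in> Js ! j} = count I \<pi>))"

lemma flattening_eqI:
  fixes xs ys :: "nat list"
  assumes "distinct xs" "ys \<in> perms (length xs)"
    and "\<And>a b. a < length xs \<Longrightarrow> b < length xs \<Longrightarrow> ys ! a < ys ! b \<longleftrightarrow> xs ! a < xs ! b"
  shows "ys = map (\<lambda>x. card {y \<in> set xs. y \<le> x}) xs"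
proof -
  have len: "length ys = length xs" and ys: "set ys = {1..length xs}" "distinct ys"
    using assms(2) by (auto simp: permutations_of_set_def dest: distinct_card)
  have le: "ys ! a \<le> ys ! b \<longleftrightarrow> xs ! a \<le> xs ! b" if "a < length xs" "b < length xs" for a b
    using assms(3)[OF that(2,1)] by linarith
  have "ys ! i = card {y \<in> set xs. y \<le> xs ! i}" if i: "i < length xs" for i
  proof -
    define S where "S = {a. a < length xs \<and> xs ! a \<le> xs ! i}"
    have "{y \<in> set xs. y \<le> xs ! i} = (!) xs ` S"
      by (auto simp: S_def in_set_conv_nth)
    moreover have "inj_on ((!) xs) S"
      using assms(1) by (auto simp: S_def inj_on_def nth_eq_iff_index_eq)
    ultimately have 1: "card {y \<in> set xs. y \<le> xs ! i} = card S"
      by (simp add: card_image)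
    have "(!) ys ` S = {y \<in> set ys. y \<le> ys ! i}"
      using le i len by (auto simp: S_def in_set_conv_nth)
    moreover have "ys ! i \<in> set ys"
      using i len by simp
    ultimately have "(!) ys ` S = {1..ys ! i}"
      unfolding ys(1) by auto
    moreover have "inj_on ((!) ys) S"
      using ys(2) len by (auto simp: S_def inj_on_def nth_eq_iff_index_eq)
    ultimately have "card S = card {1..ys ! i}"
      by (metis card_image)
    with 1 show ?thesis by simp
  qed
  then show ?thesis using len by (intro nth_equalityI) auto
qed

lemma flattening_eq_ranks:
  assumes "distinct xs"
  shows "flattening xs = map (\<lambda>x. card {y \<in> set xs. y \<le> x}) xs"
proof -
  let ?r = "\<lambda>x. card {y \<in> set xs. y \<le> x}"
  have mono: "?r x < ?r y \<longleftrightarrow> x < y" if "x \<in> set xs" "y \<in> set xs" for x y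
  proof -
    have *: "?r x < ?r y" if "x < y" "y \<in> set xs" for x y
    proof (rule psubset_card_mono)
      have "y \<in> {z \<in> set xs. z \<le> y}" "y \<notin> {z \<in> set xs. z \<le> x}" using that by auto
      moreover have "{z \<in> set xs. z \<le> x} \<subseteq> {z \<in> set xs. z \<le> y}" using that by auto
      ultimately show "{z \<in> set xs. z \<le> x} \<subset> {z \<in> set xs. z \<le> y}" by blast
    qed auto
    show ?thesis using *[of x y] *[of y x] that by (cases x y rule: linorder_cases) auto
  qed
  have inj: "inj_on ?r (set xs)"
  proof (rule inj_onI)
    fix x y assume xy: "x \<in> set xs" "y \<in> set xs" "?r x = ?r y"
    then have "\<not> x < y" "\<not> y < x" using mono[of x y] mono[of y x] by linarith+
    then show "x = y" by simp
  qed
  have sub: "?r ` set xs \<subseteq> {1..length xs}"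
  proof safe
    fix x assume x: "x \<in> set xs"
    have "?r x \<le> card (set xs)" by (intro card_mono) auto
    moreover have "?r x > 0" using x by (auto simp: card_gt_0_iff)
    ultimately show "?r x \<in> {1..length xs}" using card_length[of xs] by simp
  qed
  have "?r ` set xs = {1..length xs}"
    using sub by (rule card_subset_eq[rotated]) (auto simp: card_image[OF inj] distinct_card assms)
  then have "map ?r xs \<in> perms (length xs)"
    using inj assms by (auto simp: permutations_of_set_def distinct_map)
  moreover have "map ?r xs ! a < map ?r xs ! b \<longleftrightarrow> xs ! a < xs ! b"
    if "a < length xs" "b < length xs" for a b
    using that mono by simp
  ultimately show ?thesis
    unfolding flattening_def by (intro the_equality) (blast, rule flattening_eqI[OF assms], auto)
qed

lemma finite_prefix_tree: "finite (prefix_tree N)"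
  unfolding prefix_tree_def by auto

lemma finite_covers: "finite {q. covers N q p}"
  by (rule finite_subset[OF _ finite_prefix_tree[of N]]) (auto simp: covers_def)

end

theory Submission
  imports Defs
begin

text \<open>
  The prefixes contained in a given prefix are linearly ordered, so the prefix tree is a finite
  forest. A strike set that is an antichain wins exactly on the permutations whose strike projection
  it contains, so its winning probability is proportional to the total weight of its elements,
  where \<open>p\<close> has weight $|\sigma^{-1}(p)|$.
  A maximal antichain meets every maximal chain exactly once, hence (2) implies (1). Exchanging a
  prefix \<open>p\<close> for its covers in a maximal antichain gives (1) implies (3). Under (3) the prefixes
  of positive weight are closed under containment, and a maximal one among them is maximal in the
  tree; the permutations representing the prefixes below it form a part that can be removed from the
  multiset without destroying (3), so (2) follows by induction.
\<close>

section \<open>Containment of prefixes\<close>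

lemma restr_eq_ranks:
  assumes "distinct \<pi>"
  shows "restr i \<pi> = map (\<lambda>x. card {y \<in> set (take i \<pi>). y \<le> x}) (take i \<pi>)"
  unfolding restr_def by (rule flattening_eq_ranks) (simp add: assms)

lemma length_restr: "distinct \<pi> \<Longrightarrow> length (restr i \<pi>) = min i (length \<pi>)"
  by (simp add: restr_eq_ranks)

lemma card_le_less_iff:
  fixes x y :: nat
  assumes "finite S" "x \<in> S" "y \<in> S"
  shows "card {z \<in> S. z \<le> x} < card {z \<in> S. z \<le> y} \<longleftrightarrow> x < y"
proof
  assume "x < y"
  then have "y \<in> {z \<in> S. z \<le> y} - {z \<in> S. z \<le> x}" "{z \<in> S. z \<le> x} \<subseteq> {z \<in> S. z \<le> y}"
    using assms by auto
  then show "card {z \<in> S. z \<le> x} < card {z \<in> S. z \<le> y}"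
    using assms by (intro psubset_card_mono) auto
next
  assume less: "card {z \<in> S. z \<le> x} < card {z \<in> S. z \<le> y}"
  show "x < y"
  proof (rule ccontr)
    assume "\<not> x < y"
    then have "card {z \<in> S. z \<le> y} \<le> card {z \<in> S. z \<le> x}"
      using assms by (intro card_mono) auto
    with less show False by simp
  qed
qed

lemma restr_nth_less_iff:
  assumes "distinct \<pi>" "a < i" "b < i" "i \<le> length \<pi>"
  shows "restr i \<pi> ! a < restr i \<pi> ! b \<longleftrightarrow> \<pi> ! a < \<pi> ! b"
proof -
  have "\<pi> ! a \<in> set (take i \<pi>)" "\<pi> ! b \<in> set (take i \<pi>)"
    using assms by (auto simp: in_set_conv_nth)
  then show ?thesis
    using assms card_le_less_iff[of "set (take i \<pi>)" "\<pi> ! a" "\<pi> ! b"]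
    by (simp add: restr_eq_ranks)
qed

text \<open>Taking ranks is injective on the \<open>i\<close> distinct entries with values in
  \<open>{1..i}\<close>, hence onto by counting.\<close>

lemma restr_in_perms:
  assumes "distinct \<pi>" "i \<le> length \<pi>"
  shows "restr i \<pi> \<in> perms i"
proof -
  define r where "r = (\<lambda>x. card {y \<in> set (take i \<pi>). y \<le> x})"
  have inj: "inj_on r (set (take i \<pi>))"
  proof (rule inj_onI)
    fix x y assume "x \<in> set (take i \<pi>)" "y \<in> set (take i \<pi>)" "r x = r y"
    then show "x = y"
      using card_le_less_iff[of "set (take i \<pi>)" x y] card_le_less_iff[of "set (take i \<pi>)" y x]
      unfolding r_def by (metis List.finite_set less_irrefl linorder_neqE_nat)
  qed
  have card: "card (set (take i \<pi>)) = i"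
    using assms by (simp add: distinct_card)
  have "r ` set (take i \<pi>) \<subseteq> {1..i}"
  proof safe
    fix x assume x: "x \<in> set (take i \<pi>)"
    have "r x \<le> card (set (take i \<pi>))"
      unfolding r_def by (intro card_mono) auto
    moreover have "r x > 0"
      using x by (auto simp: r_def card_gt_0_iff)
    ultimately show "r x \<in> {1..i}" using card by simp
  qed
  then have "r ` set (take i \<pi>) = {1..i}"
    by (rule card_subset_eq[rotated]) (auto simp: card_image[OF inj] card)
  moreover have "restr i \<pi> = map r (take i \<pi>)"
    using assms by (simp add: restr_eq_ranks r_def)
  ultimately show ?thesis
    using inj assms by (auto simp: permutations_of_set_def distinct_map)
qed

text \<open>A flattening depends only on the relative order of the entries, and
  \<open>restr j\<close> preserves that order. Transitivity and linearity of containment both rest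
  on this.\<close>

lemma restr_restr:
  assumes "distinct \<pi>" "i \<le> j" "j \<le> length \<pi>"
  shows "restr i (restr j \<pi>) = restr i \<pi>"
proof -
  have len: "length (take i (restr j \<pi>)) = length (take i \<pi>)"
    using assms by (simp add: length_restr)
  have "take i (restr j \<pi>) ! a < take i (restr j \<pi>) ! b \<longleftrightarrow> take i \<pi> ! a < take i \<pi> ! b"
    if "a < length (take i \<pi>)" "b < length (take i \<pi>)" for a b
    using that assms restr_nth_less_iff[of \<pi> a j b] by simp
  then have "flattening (take i (restr j \<pi>)) = flattening (take i \<pi>)"
    unfolding flattening_def len by (intro arg_cong[where f = The] ext) auto
  then show ?thesis by (simp add: restr_def)
qed

lemma restr_perms:
  assumes "\<pi> \<in> perms n"
  shows "restr n \<pi> = \<pi>"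
proof -
  have \<pi>: "set \<pi> = {1..n}" "distinct \<pi>" "length \<pi> = n"
    using assms by (auto simp: permutations_of_set_def dest: distinct_card)
  have "card {y \<in> set \<pi>. y \<le> x} = x" if "x \<in> set \<pi>" for x
  proof -
    have "{y \<in> set \<pi>. y \<le> x} = {1..x}" using that \<pi>(1) by auto
    then show ?thesis by simp
  qed
  then show ?thesis
    using \<pi>(2,3) by (simp add: restr_eq_ranks map_idI)
qed

lemma perms_props:
  assumes "\<pi> \<in> perms n"
  shows "distinct \<pi>" "length \<pi> = n"
  using assms by (auto simp: permutations_of_set_def dest: distinct_card)

section \<open>Containment as the order of a forest\<close>

lemma prefix_treeD:
  assumes "p \<in> prefix_tree N"
  shows "p \<in> perms (length p)" "distinct p"
proof -
  obtain i where "p \<in> perms i" using assms by (auto simp: prefix_tree_def)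
  with perms_props[OF this] show "p \<in> perms (length p)" "distinct p" by simp_all
qed

lemma contained_in_refl: "p \<in> prefix_tree N \<Longrightarrow> contained_in p p"
  using restr_perms[OF prefix_treeD(1)] by (simp add: contained_in_def)

lemma contained_in_trans:
  assumes "contained_in p q" "contained_in q r" "r \<in> prefix_tree N"
  shows "contained_in p r"
  using assms restr_restr[of r "length p" "length q"] prefix_treeD[of r N]
  by (auto simp: contained_in_def)

text \<open>Antisymmetry phrased through sizes: it turns a longest or shortest element of a finite
  set of prefixes into a maximal or minimal one.\<close>

lemma contained_in_length_eq:
  assumes "contained_in p q" "length q \<le> length p" "q \<in> prefix_tree N"
  shows "p = q"
proof -
  have len: "length p = length q" and restr: "restr (length p) q = p"
    using assms(1,2) unfolding contained_in_def by linarith+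
  show ?thesis
    using restr[unfolded len] restr_perms[OF prefix_treeD(1)[OF assms(3)]] by (rule trans[OF sym])
qed

text \<open>Both prefixes are restrictions of \<open>r\<close>, so the shorter one is a restriction
  of the longer one.\<close>

lemma contained_in_linear:
  assumes "contained_in p r" "contained_in q r" "r \<in> prefix_tree N"
  shows "contained_in p q \<or> contained_in q p"
proof -
  have *: "contained_in x y"
    if "contained_in x r" "contained_in y r" "length x \<le> length y" for x y
    using that restr_restr[of r "length x" "length y"] prefix_treeD[OF assms(3)]
    by (auto simp: contained_in_def)
  show ?thesis using *[of p q] *[of q p] assms by linarith
qed

lemma finite_obtains_max:
  fixes f :: "'a \<Rightarrow> 'b::linorder"
  assumes "finite S" "S \<noteq> {}"
  obtains m where "m \<in> S" "\<And>x. x \<in> S \<Longrightarrow> f x \<le> f m"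
proof -
  have "Max (f ` S) \<in> f ` S" using assms by simp
  then obtain m where "m \<in> S" "f m = Max (f ` S)" by auto
  then show ?thesis using that assms(1) by simp
qed

section \<open>Covers, maximal chains and maximal antichains\<close>

text \<open>A longest element of the finite set of prefixes containing \<open>p\<close> is
  maximal.\<close>

lemma maximal_prefix_above:
  assumes "p \<in> prefix_tree N"
  obtains m where "maximal_prefix N m" "contained_in p m"
proof -
  let ?U = "{q \<in> prefix_tree N. contained_in p q}"
  have "finite ?U" "?U \<noteq> {}"
    using finite_prefix_tree[of N] contained_in_refl assms by auto
  then obtain m where m: "m \<in> ?U" "\<And>q. q \<in> ?U \<Longrightarrow> length q \<le> length m"
    using finite_obtains_max[of ?U length] by blast
  have "maximal_prefix N m"
    unfolding maximal_prefix_def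
  proof (intro conjI ballI impI)
    fix q assume q: "q \<in> prefix_tree N" "contained_in m q"
    then have "contained_in p q" using m(1) contained_in_trans by blast
    then show "q = m" using q m(2) contained_in_length_eq by blast
  qed (use m in blast)
  then show ?thesis using m that by blast
qed

text \<open>The two covers are comparable, as both lie below \<open>m\<close>; if distinct, the
  smaller would lie strictly between \<open>p\<close> and the larger.\<close>

lemma cover_below_unique:
  assumes "covers N q p" "covers N q' p" "contained_in q m" "contained_in q' m"
    and "m \<in> prefix_tree N"
  shows "q = q'"
  using contained_in_linear[OF assms(3-5)]
proof
  assume "contained_in q q'"
  then show ?thesis using assms(1,2) by (auto simp: covers_def)
next
  assume "contained_in q' q"
  then show ?thesis using assms(1,2) by (auto simp: covers_def)
qed

text \<open>The cover is a shortest prefix strictly above \<open>p\<close> and contained in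
  \<open>m\<close>.\<close>

lemma cover_below:
  assumes "p \<in> prefix_tree N" "m \<in> prefix_tree N" "contained_in p m" "p \<noteq> m"
  obtains q where "covers N q p" "contained_in q m"
proof -
  let ?U = "{q \<in> prefix_tree N. q \<noteq> p \<and> contained_in p q \<and> contained_in q m}"
  have "finite ?U" "?U \<noteq> {}"
    using finite_prefix_tree[of N] contained_in_refl assms by auto
  then obtain q where q: "q \<in> ?U" "\<And>r. r \<in> ?U \<Longrightarrow> length q \<le> length r"
    using ex_is_arg_min_if_finite[of ?U length] by (auto simp: is_arg_min_linorder)
  have "\<not> (r \<noteq> p \<and> r \<noteq> q \<and> contained_in p r \<and> contained_in r q)"
    if r: "r \<in> prefix_tree N" for r
  proof
    assume r': "r \<noteq> p \<and> r \<noteq> q \<and> contained_in p r \<and> contained_in r q"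
    then have "contained_in r m" using q(1) contained_in_trans assms(2) by blast
    then have "length q \<le> length r" using q(2) r r' by blast
    then show False using r' contained_in_length_eq q(1) by blast
  qed
  then have "covers N q p" using q(1) assms(1) by (auto simp: covers_def)
  then show ?thesis using q(1) that by blast
qed

text \<open>The indicator of the prefixes below a maximal \<open>m\<close> satisfies the cover-sum
  identity, since a branch through \<open>p\<close> passes through exactly one cover of
  \<open>p\<close>. This is what allows a single chain to be subtracted from the fiber
  sizes.\<close>

lemma sum_covers_below:
  assumes p: "p \<in> prefix_tree N" "\<not> maximal_prefix N p" and m: "maximal_prefix N m"
  shows "(\<Sum>q | covers N q p. of_bool (contained_in q m)) = (of_bool (contained_in p m) :: nat)"
proof (cases "contained_in p m")
  case True
  have mP: "m \<in> prefix_tree N" using m by (simp add: maximal_prefix_def)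
  then obtain q where q: "covers N q p" "contained_in q m"
    using cover_below[OF p(1) mP True] p(2) m by metis
  have "{q. covers N q p} \<inter> {q. contained_in q m} = {q}"
    using q cover_below_unique[OF _ _ _ _ mP] by blast
  then show ?thesis using True finite_covers by (simp add: sum.If_cases of_bool_def)
next
  case False
  then have "\<not> contained_in q m" if "covers N q p" for q
    using that m contained_in_trans unfolding covers_def maximal_prefix_def by blast
  then show ?thesis using False by simp
qed

text \<open>A chain extending this set contains \<open>m\<close>, so each of its members is
  comparable to \<open>m\<close> and, \<open>m\<close> being maximal, lies below it.\<close>

lemma maximal_chain_below:
  assumes m: "maximal_prefix N m"
  shows "maximal_chain N {p \<in> prefix_tree N. contained_in p m}" (is "maximal_chain N ?C")
proof -
  have mP: "m \<in> prefix_tree N" using m by (simp add: maximal_prefix_def)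
  have chain: "pred_on.chain (prefix_tree N) contained_in ?C"
    unfolding pred_on.chain_def using contained_in_linear[OF _ _ mP] by blast
  have "S \<subseteq> ?C" if S: "pred_on.chain (prefix_tree N) contained_in S" "?C \<subseteq> S" for S
  proof
    fix x assume x: "x \<in> S"
    have mS: "m \<in> S" using S(2) mP contained_in_refl by blast
    have xP: "x \<in> prefix_tree N" using S(1) x by (auto simp: pred_on.chain_def)
    have "contained_in x m \<or> contained_in m x"
      using S(1) x mS contained_in_refl[OF xP] by (auto simp: pred_on.chain_def)
    then show "x \<in> ?C"
      using m xP contained_in_refl[OF xP] by (auto simp: maximal_prefix_def)
  qed
  then show ?thesis
    unfolding maximal_chain_def pred_on.maxchain_def using chain by blast
qed

text \<open>Conversely, a chain with an upper bound \<open>x\<close> lies below any maximal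
  \<open>m\<close> above \<open>x\<close>; the prefixes below \<open>m\<close> form a chain, so
  maximality of \<open>C\<close> gives equality.\<close>

lemma maximal_chainE:
  assumes C: "maximal_chain N C" and "prefix_tree N \<noteq> {}"
  obtains m where "maximal_prefix N m" "C = {p \<in> prefix_tree N. contained_in p m}"
proof -
  have CP: "C \<subseteq> prefix_tree N"
    and linC: "\<And>x y. x \<in> C \<Longrightarrow> y \<in> C \<Longrightarrow> contained_in x y \<or> contained_in y x"
    and maxC: "\<And>S. pred_on.chain (prefix_tree N) contained_in S \<Longrightarrow> C \<subseteq> S \<Longrightarrow> C = S"
    using C contained_in_refl
    unfolding maximal_chain_def pred_on.maxchain_def pred_on.chain_def by blast+
  obtain x where x: "x \<in> prefix_tree N" "\<forall>p\<in>C. contained_in p x"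
  \<comment> \<open>An empty \<open>C\<close> has no longest element, but every prefix in the
    nonempty tree bounds it vacuously.\<close>
  proof (cases "C = {}")
    case True
    then show ?thesis using assms(2) that by blast
  next
    case False
    then obtain x where x: "x \<in> C" "\<And>p. p \<in> C \<Longrightarrow> length p \<le> length x"
      using finite_obtains_max[OF finite_subset[OF CP finite_prefix_tree], of length] by blast
    have "contained_in p x" if p: "p \<in> C" for p
      using linC[OF p x(1)]
    proof
      assume "contained_in x p"
      then have "x = p" using contained_in_length_eq x(2)[OF p] p CP by blast
      then show ?thesis using contained_in_refl p CP by blast
    qed
    then show ?thesis using x(1) CP that by blast
  qed
  obtain m where m: "maximal_prefix N m" "contained_in x m"
    using maximal_prefix_above[OF x(1)] .
  then have "C \<subseteq> {p \<in> prefix_tree N. contained_in p m}"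
    using x CP contained_in_trans unfolding maximal_prefix_def by blast
  moreover have "pred_on.chain (prefix_tree N) contained_in {p \<in> prefix_tree N. contained_in p m}"
    using maximal_chain_below[OF m(1)] by (simp add: maximal_chain_def pred_on.maxchain_def)
  ultimately show ?thesis using maxC m(1) that by blast
qed

text \<open>Let \<open>m\<close> be the top of the chain. Some element of \<open>A\<close> is
  comparable to \<open>m\<close>, hence below it; two such elements would be comparable to each
  other.\<close>

lemma maximal_antichain_meets_maximal_chain:
  assumes A: "maximal_antichain N A" and C: "maximal_chain N C" and "prefix_tree N \<noteq> {}"
  shows "card (A \<inter> C) = 1"
proof -
  obtain m where m: "maximal_prefix N m" and C_eq: "C = {p \<in> prefix_tree N. contained_in p m}"
    using maximal_chainE[OF C assms(3)] .
  have mP: "m \<in> prefix_tree N" using m by (simp add: maximal_prefix_def)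
  have AP: "A \<subseteq> prefix_tree N" using A by (simp add: maximal_antichain_def)
  obtain a where a: "a \<in> A" "contained_in a m \<or> contained_in m a"
    using A mP by (auto simp: maximal_antichain_def)
  then have am: "contained_in a m"
    using m AP contained_in_refl[OF mP] unfolding maximal_prefix_def by blast
  have "b = a" if "b \<in> A" "contained_in b m" for b
    using that a(1) am contained_in_linear[OF _ _ mP] A unfolding maximal_antichain_def by blast
  then have "A \<inter> C = {a}" using a(1) am AP C_eq by blast
  then show ?thesis by simp
qed

text \<open>Checking maximal prefixes suffices: if \<open>p\<close> and \<open>a\<close> both lie
  below a maximal \<open>m\<close>, they are comparable.\<close>

lemma maximal_antichainI:
  assumes "A \<subseteq> prefix_tree N"
    and "\<And>p q. p \<in> A \<Longrightarrow> q \<in> A \<Longrightarrow> contained_in p q \<Longrightarrow> p = q"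
    and "\<And>m. maximal_prefix N m \<Longrightarrow> \<exists>a\<in>A. contained_in a m"
  shows "maximal_antichain N A"
proof -
  have "\<exists>a\<in>A. contained_in a p \<or> contained_in p a" if p: "p \<in> prefix_tree N" for p
  proof -
    obtain m where m: "maximal_prefix N m" "contained_in p m"
      using maximal_prefix_above[OF p] .
    then show ?thesis
      using assms(3)[OF m(1)] contained_in_linear unfolding maximal_prefix_def by blast
  qed
  then show ?thesis using assms(1,2) by (auto simp: maximal_antichain_def)
qed

text \<open>First half of an exchange: this antichain and the next one share all maximal prefixes
  not above \<open>p\<close> and differ only in \<open>p\<close> versus its covers.\<close>

lemma maximal_antichain_insert:
  assumes p: "p \<in> prefix_tree N"
  shows "maximal_antichain N (insert p {m. maximal_prefix N m \<and> \<not> contained_in p m})"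
proof (rule maximal_antichainI)
  fix x y
  assume xy: "x \<in> insert p {m. maximal_prefix N m \<and> \<not> contained_in p m}"
    "y \<in> insert p {m. maximal_prefix N m \<and> \<not> contained_in p m}" "contained_in x y"
  then have "y \<in> prefix_tree N" using p by (auto simp: maximal_prefix_def)
  then show "x = y" using xy unfolding maximal_prefix_def by blast
next
  fix m assume m: "maximal_prefix N m"
  then show "\<exists>a\<in>insert p {m. maximal_prefix N m \<and> \<not> contained_in p m}. contained_in a m"
    using contained_in_refl[of m N] by (auto simp: maximal_prefix_def)
qed (use p in \<open>auto simp: maximal_prefix_def\<close>)

lemma maximal_antichain_covers:
  assumes p: "p \<in> prefix_tree N" "\<not> maximal_prefix N p"
  shows "maximal_antichain N ({q. covers N q p} \<union> {m. maximal_prefix N m \<and> \<not> contained_in p m})"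
    (is "maximal_antichain N (?Q \<union> ?M)")
proof (rule maximal_antichainI)
  show "?Q \<union> ?M \<subseteq> prefix_tree N" by (auto simp: covers_def maximal_prefix_def)
  fix x y assume xy: "x \<in> ?Q \<union> ?M" "y \<in> ?Q \<union> ?M" "contained_in x y"
  then have yP: "y \<in> prefix_tree N" by (auto simp: covers_def maximal_prefix_def)
  show "x = y"
  proof (cases "x \<in> ?M")
    case True
    then show ?thesis using xy(3) yP by (auto simp: maximal_prefix_def)
  next
    case False
    then have x: "covers N x p" using xy(1) by blast
    \<comment> \<open>This excludes \<open>y\<close> from \<open>?M\<close>, so \<open>x\<close> and
      \<open>y\<close> are both covers of \<open>p\<close>, and both lie below
      \<open>y\<close>.\<close>
    then have "contained_in p y"
      using xy(3) yP contained_in_trans unfolding covers_def by blast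
    then have y: "covers N y p" using xy(2) by blast
    show ?thesis using cover_below_unique[OF x y xy(3) contained_in_refl[OF yP] yP] .
  qed
next
  fix m assume m: "maximal_prefix N m"
  then have mP: "m \<in> prefix_tree N" by (simp add: maximal_prefix_def)
  show "\<exists>a\<in>?Q \<union> ?M. contained_in a m"
  proof (cases "contained_in p m")
    case True
    then obtain q where "covers N q p" "contained_in q m"
      using cover_below[OF p(1) mP] p(2) m by metis
    then show ?thesis by blast
  next
    case False
    then show ?thesis using m contained_in_refl[OF mP] by blast
  qed
qed

section \<open>Winning probabilities\<close>

lemma strike_position:
  assumes "\<pi> \<in> perms N" "N \<ge> 1"
  obtains i where "i < N" "\<pi> ! i = N" "strike_projection N \<pi> = restr (Suc i) \<pi>"
    "\<And>j. j < N \<Longrightarrow> \<pi> ! j = N \<Longrightarrow> j = i"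
proof -
  have \<pi>: "distinct \<pi>" "length \<pi> = N" using perms_props[OF assms(1)] by auto
  have "N \<in> set \<pi>" using assms by (auto simp: permutations_of_set_def)
  then obtain i where i: "i < N" "\<pi> ! i = N" using \<pi> by (auto simp: in_set_conv_nth)
  have uniq: "j = i" if "j < N" "\<pi> ! j = N" for j
    using that i \<pi> by (metis nth_eq_iff_index_eq)
  have "(THE i. i < length \<pi> \<and> \<pi> ! i = N) = i"
    unfolding \<pi>(2) using i uniq by (intro the_equality) blast+
  then have "strike_projection N \<pi> = restr (Suc i) \<pi>"
    by (simp only: strike_projection_def)
  then show ?thesis using that i uniq by blast
qed

text \<open>The entry \<open>N\<close> exceeds all others, so it is a left-to-right maximum, and
  flattening keeps it one.\<close>

lemma strike_projection_in_prefix_tree: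
  assumes "\<pi> \<in> perms N" "N \<ge> 1"
  shows "strike_projection N \<pi> \<in> prefix_tree N"
proof -
  obtain i where i: "i < N" "\<pi> ! i = N" "strike_projection N \<pi> = restr (Suc i) \<pi>"
    and uniq: "\<And>j. j < N \<Longrightarrow> \<pi> ! j = N \<Longrightarrow> j = i"
    using strike_position[OF assms] by metis
  have \<pi>: "distinct \<pi>" "length \<pi> = N" "set \<pi> = {1..N}"
    using perms_props[OF assms(1)] assms(1) by (auto simp: permutations_of_set_def)
  have "restr (Suc i) \<pi> ! j < restr (Suc i) \<pi> ! i" if "j < i" for j
  proof -
    have "\<pi> ! j \<in> {1..N}" using that i(1) \<pi> nth_mem[of j \<pi>] by simp
    moreover have "\<pi> ! j \<noteq> N" using uniq[of j] that i(1) by auto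
    ultimately show ?thesis using restr_nth_less_iff[of \<pi> j "Suc i" i] that i \<pi> by simp
  qed
  then have "left_to_right_maximum (restr (Suc i) \<pi>) (length (restr (Suc i) \<pi>) - 1)"
    using i(1) \<pi> by (simp add: left_to_right_maximum_def length_restr)
  then show ?thesis
    using restr_in_perms[of \<pi> "Suc i"] i \<pi> by (auto simp: prefix_tree_def)
qed

text \<open>If the strike projection lies in \<open>A\<close>, stopping earlier would put a shorter
  prefix contained in it into \<open>A\<close> as well, contradicting the antichain
  property.\<close>

lemma wins_iff:
  assumes "maximal_antichain N A" "\<pi> \<in> perms N" "N \<ge> 1"
  shows "wins N A \<pi> \<longleftrightarrow> strike_projection N \<pi> \<in> A"
proof -
  obtain i where i: "i < N" "\<pi> ! i = N" "strike_projection N \<pi> = restr (Suc i) \<pi>"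
    and uniq: "\<And>j. j < N \<Longrightarrow> \<pi> ! j = N \<Longrightarrow> j = i"
    using strike_position[OF assms(2,3)] by metis
  have \<pi>: "distinct \<pi>" "length \<pi> = N" using perms_props[OF assms(2)] by auto
  have "restr (Suc j) \<pi> \<notin> A" if j: "j < i" and in_A: "restr (Suc i) \<pi> \<in> A" for j
  proof
    assume "restr (Suc j) \<pi> \<in> A"
    moreover have "contained_in (restr (Suc j) \<pi>) (restr (Suc i) \<pi>)"
      using j i(1) \<pi> by (simp add: contained_in_def length_restr restr_restr)
    ultimately have "restr (Suc j) \<pi> = restr (Suc i) \<pi>"
      using in_A assms(1) by (auto simp: maximal_antichain_def)
    then have "length (restr (Suc j) \<pi>) = length (restr (Suc i) \<pi>)" by simp
    then show False using j i(1) \<pi> by (simp add: length_restr)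
  qed
  then show ?thesis
    unfolding wins_def stops_at_def \<pi>(2) i(3) using i(1,2) uniq by blast
qed

lemma win_probability_eq:
  assumes "maximal_antichain N A" "N \<ge> 1" "I \<noteq> {#}" "set_mset I \<subseteq> perms N"
  shows "win_probability N I A = size {#\<pi> \<in># I. strike_projection N \<pi> \<in> A#} / size I"
proof -
  have "{#\<pi> \<in># I. wins N A \<pi>#} = {#\<pi> \<in># I. strike_projection N \<pi> \<in> A#}"
    using wins_iff[OF assms(1) _ assms(2)] assms(4) by (intro filter_mset_cong) auto
  \<comment> \<open>Cutting the event down to the finite support makes its probability a finite sum
    of point masses.\<close>
  moreover have "win_probability N I A = (\<Sum>\<pi>\<in>{\<pi>. wins N A \<pi>} \<inter> set_mset I. count I \<pi> / size I)"
    unfolding win_probability_def using assms(3)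
    by (subst measure_Int_set_pmf[symmetric]) (simp add: measure_measure_pmf_finite)
  moreover have "size {#\<pi> \<in># I. wins N A \<pi>#} = (\<Sum>\<pi>\<in>{\<pi>. wins N A \<pi>} \<inter> set_mset I. count I \<pi>)"
    unfolding size_multiset_overloaded_eq by (intro sum.cong) auto
  ultimately show ?thesis
    by (simp add: sum_divide_distrib)
qed

lemma strategy_indifferent_iff:
  assumes "N \<ge> 1" "I \<noteq> {#}" "set_mset I \<subseteq> perms N"
  shows "strategy_indifferent N I \<longleftrightarrow>
    (\<forall>A B. maximal_antichain N A \<longrightarrow> maximal_antichain N B \<longrightarrow>
      size {#\<pi> \<in># I. strike_projection N \<pi> \<in> A#} = size {#\<pi> \<in># I. strike_projection N \<pi> \<in> B#})"
  using assms by (auto simp: strategy_indifferent_def win_probability_eq)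

lemma size_filter_mem_eq_sum:
  assumes "finite A"
  shows "size {#x \<in># M. f x \<in> A#} = (\<Sum>a\<in>A. size {#x \<in># M. f x = a#})"
  using assms
proof (induction A)
  case empty
  then show ?case by simp
next
  case (insert a A)
  have "{#x \<in># M. f x \<in> insert a A#} = {#x \<in># M. f x = a#} + {#x \<in># M. f x \<in> A#}"
    using insert.hyps by (intro multiset_eqI) auto
  then show ?case using insert by simp
qed

section \<open>The three implications\<close>

text \<open>Double counting: each part has exactly one permutation with strike projection in
  \<open>A\<close>, so the number of winning permutations is the number of parts, whatever
  \<open>A\<close> is.\<close>

lemma chain_partition_imp_strategy_indifferent:
  assumes N: "N \<ge> 1" and I: "I \<noteq> {#}" "set_mset I \<subseteq> perms N"
    and part: "has_maximal_chain_partition N I"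
  shows "strategy_indifferent N I"
proof -
  let ?\<sigma> = "strike_projection N"
  obtain Js where Js: "\<forall>J\<in>set Js. maximal_saturated_chain N J"
    and count: "\<And>\<pi>. \<pi> \<in> perms N \<Longrightarrow> card {j. j < length Js \<and> \<pi> \<in> Js ! j} = count I \<pi>"
    using part by (auto simp: has_maximal_chain_partition_def)
  have ne: "prefix_tree N \<noteq> {}"
    using I strike_projection_in_prefix_tree[OF _ N] by blast
  have "size {#\<pi> \<in># I. ?\<sigma> \<pi> \<in> A#} = length Js" if A: "maximal_antichain N A" for A
  proof -
    have "size {#\<pi> \<in># I. ?\<sigma> \<pi> \<in> A#} = (\<Sum>\<pi>\<in>perms N. count {#\<pi> \<in># I. ?\<sigma> \<pi> \<in> A#} \<pi>)"
      unfolding size_multiset_overloaded_eq using I(2)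
      by (intro sum.mono_neutral_left) (auto simp: not_in_iff)
    also have "\<dots> = (\<Sum>\<pi> | \<pi> \<in> perms N \<and> ?\<sigma> \<pi> \<in> A. count I \<pi>)"
      by (intro sum.mono_neutral_cong_right) auto
    also have "\<dots> = (\<Sum>\<pi> | \<pi> \<in> perms N \<and> ?\<sigma> \<pi> \<in> A. card {j \<in> {..<length Js}. \<pi> \<in> Js ! j})"
      using count by (intro sum.cong) auto
    \<comment> \<open>Incidences between permutations and parts are now counted part by
      part.\<close>
    also have "\<dots> = (\<Sum>j<length Js. card {\<pi> \<in> {\<pi> \<in> perms N. ?\<sigma> \<pi> \<in> A}. \<pi> \<in> Js ! j})"
      by (rule sum_multicount_gen) auto
    also have "\<dots> = (\<Sum>j<length Js. 1)"
    proof (rule sum.cong)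
      fix j assume "j \<in> {..<length Js}"
      then have "maximal_saturated_chain N (Js ! j)" using Js by simp
      then obtain C where C: "maximal_chain N C" "bij_betw ?\<sigma> (Js ! j) C" "Js ! j \<subseteq> perms N"
        by (auto simp: maximal_saturated_chain_def)
      have eq: "{\<pi> \<in> {\<pi> \<in> perms N. ?\<sigma> \<pi> \<in> A}. \<pi> \<in> Js ! j} = {\<pi> \<in> Js ! j. ?\<sigma> \<pi> \<in> A}" (is "_ = ?S")
        using C(3) by auto
      have "?\<sigma> ` ?S = A \<inter> C" "inj_on ?\<sigma> ?S"
        using C(2) by (auto simp: bij_betw_def inj_on_def)
      then have "card ?S = card (A \<inter> C)" by (metis card_image)
      then show "card {\<pi> \<in> {\<pi> \<in> perms N. ?\<sigma> \<pi> \<in> A}. \<pi> \<in> Js ! j} = 1"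
        using maximal_antichain_meets_maximal_chain[OF A C(1) ne] eq by simp
    qed simp
    finally show ?thesis by simp
  qed
  then show ?thesis by (simp add: strategy_indifferent_iff[OF N I])
qed

lemma strategy_indifferent_imp_cover_sum:
  assumes N: "N \<ge> 1" and I: "I \<noteq> {#}" "set_mset I \<subseteq> perms N"
    and indiff: "strategy_indifferent N I"
    and p: "p \<in> prefix_tree N" "\<not> maximal_prefix N p"
  shows "fiber_size N I p = (\<Sum>q | covers N q p. fiber_size N I q)"
proof -
  let ?M = "{m. maximal_prefix N m \<and> \<not> contained_in p m}"
  let ?Q = "{q. covers N q p}"
  have fin: "finite ?M"
    by (rule finite_subset[OF _ finite_prefix_tree[of N]]) (auto simp: maximal_prefix_def)
  have "p \<notin> ?M" "?Q \<inter> ?M = {}"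
    using contained_in_refl p(1) by (auto simp: covers_def)
  \<comment> \<open>Indifference applied to the two exchanged antichains; the common part
    \<open>?M\<close> then cancels.\<close>
  moreover have "sum (fiber_size N I) (insert p ?M) = sum (fiber_size N I) (?Q \<union> ?M)"
  proof -
    have weight: "sum (fiber_size N I) A = size {#\<pi> \<in># I. strike_projection N \<pi> \<in> A#}"
      if "finite A" for A
      unfolding fiber_size_def by (rule size_filter_mem_eq_sum[OF that, symmetric])
    have "size {#\<pi> \<in># I. strike_projection N \<pi> \<in> insert p ?M#} =
        size {#\<pi> \<in># I. strike_projection N \<pi> \<in> ?Q \<union> ?M#}"
      using indiff maximal_antichain_insert[OF p(1)] maximal_antichain_covers[OF p]
      unfolding strategy_indifferent_iff[OF N I] by blast
    then show ?thesis
      using weight[of "insert p ?M"] weight[of "?Q \<union> ?M"] fin finite_covers[of N p] by simp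
  qed
  ultimately show ?thesis
    using fin finite_covers[of N p] by (simp add: sum.union_disjoint)
qed

text \<open>One step from \<open>p\<close> towards \<open>q\<close> reaches a cover
  \<open>r\<close>, whose weight is a summand of \<open>w p\<close>; induction on the difference in
  size does the rest.\<close>

lemma cover_sum_positive_below:
  assumes sum: "\<And>p. p \<in> prefix_tree N \<Longrightarrow> \<not> maximal_prefix N p \<Longrightarrow>
      w p = (\<Sum>q | covers N q p. w q)"
    and "contained_in p q" "p \<in> prefix_tree N" "q \<in> prefix_tree N" "w q > (0::nat)"
  shows "w p > 0"
  using assms(2-)
proof (induction "length q - length p" arbitrary: p rule: less_induct)
  case less
  show ?case
  proof (cases "p = q")
    case False
    obtain r where r: "covers N r p" "contained_in r q"
      using cover_below[OF less.prems(2,3,1) False] .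
    have rP: "r \<in> prefix_tree N" "contained_in p r" "r \<noteq> p"
      using r(1) by (auto simp: covers_def)
    have "\<not> length r \<le> length p" using contained_in_length_eq[OF rP(2) _ rP(1)] rP(3) by auto
    moreover have "length r \<le> length q" using r(2) by (simp add: contained_in_def)
    ultimately have "w r > 0" using less.hyps[of r] r(2) rP(1) less.prems by linarith
    moreover have "w r \<le> (\<Sum>q | covers N q p. w q)"
      using r(1) finite_covers by (intro member_le_sum) auto
    moreover have "\<not> maximal_prefix N p"
      using rP unfolding maximal_prefix_def by blast
    ultimately show ?thesis using sum less.prems(2) by fastforce
  qed (use less.prems in simp)
qed

lemma cover_sum_imp_chain_partition:
  assumes N: "N \<ge> 1" and "set_mset I \<subseteq> perms N"
    and "\<And>p. p \<in> prefix_tree N \<Longrightarrow> \<not> maximal_prefix N p \<Longrightarrow>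
      fiber_size N I p = (\<Sum>q | covers N q p. fiber_size N I q)"
  shows "has_maximal_chain_partition N I"
  using assms(2-)
proof (induction "size I" arbitrary: I rule: less_induct)
  case less
  let ?\<sigma> = "strike_projection N"
  show ?case
  proof (cases "I = {#}")
    case True
    then show ?thesis
      by (auto simp: has_maximal_chain_partition_def intro!: exI[of _ "[]"])
  next
    case False
    have pos_iff: "fiber_size N I p > 0 \<longleftrightarrow> (\<exists>\<pi>. \<pi> \<in># I \<and> ?\<sigma> \<pi> = p)" for p
      by (auto simp: fiber_size_def simp flip: nonempty_has_size set_mset_eq_empty_iff)
    let ?S = "{p \<in> prefix_tree N. fiber_size N I p > 0}"
    obtain \<pi> where "\<pi> \<in># I" using False by blast
    then have "?\<sigma> \<pi> \<in> ?S"
      using strike_projection_in_prefix_tree[OF _ N] less.prems(1) pos_iff by blast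
    then have "finite ?S" "?S \<noteq> {}" using finite_prefix_tree[of N] by auto
    then obtain m where m: "m \<in> ?S" "\<And>q. q \<in> ?S \<Longrightarrow> length q \<le> length m"
      using finite_obtains_max[of ?S length] by blast
    have max: "maximal_prefix N m"
    proof (rule ccontr)
      assume not_max: "\<not> maximal_prefix N m"
      \<comment> \<open>A cover is longer than \<open>m\<close>, which was chosen longest among the
        prefixes of positive weight. The cover sum at \<open>m\<close> would therefore
        vanish.\<close>
      have "fiber_size N I q = 0" if q: "covers N q m" for q
      proof (rule ccontr)
        assume "fiber_size N I q \<noteq> 0"
        moreover have qP: "q \<in> prefix_tree N" "contained_in m q" "q \<noteq> m"
          using q by (simp_all add: covers_def)
        ultimately have "length q \<le> length m" using m(2) by simp
        then show False using contained_in_length_eq[OF qP(2) _ qP(1)] qP(3) by blast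
      qed
      then have "fiber_size N I m = 0" using less.prems(2)[OF _ not_max] m(1) by simp
      then show False using m(1) by simp
    qed
    define C where "C = {p \<in> prefix_tree N. contained_in p m}"
    \<comment> \<open>Positivity descends from \<open>m\<close> to all of \<open>C\<close>, so each
      prefix there has a representative \<open>g p\<close> in \<open>I\<close>.\<close>
    have "\<forall>p\<in>C. \<exists>\<pi>. \<pi> \<in># I \<and> ?\<sigma> \<pi> = p"
      using cover_sum_positive_below[OF less.prems(2), where q = m] m(1) pos_iff
      by (auto simp: C_def)
    then obtain g where g: "\<And>p. p \<in> C \<Longrightarrow> g p \<in># I" "\<And>p. p \<in> C \<Longrightarrow> ?\<sigma> (g p) = p"
      by metis
    define J where "J = g ` C"
    have finJ: "finite J" using finite_prefix_tree by (simp add: J_def C_def)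
    have sub: "mset_set J \<subseteq># I"
      using finJ g(1) by (auto simp: subseteq_mset_def J_def count_mset_set' Suc_le_eq)
    define I' where "I' = I - mset_set J"
    have I_eq: "I = I' + mset_set J" using sub by (simp add: I'_def)
    have "m \<in> C" using m(1) contained_in_refl[of m N] by (simp add: C_def)
    then have smaller: "size I' < size I" using I_eq finJ by (auto simp: J_def card_gt_0_iff)
    \<comment> \<open>As \<open>?\<sigma>\<close> inverts \<open>g\<close> on \<open>C\<close>, the
      removed part has one permutation over each prefix below \<open>m\<close> and none over the
      others.\<close>
    have fiber: "fiber_size N I p = fiber_size N I' p + of_bool (contained_in p m)"
      if p: "p \<in> prefix_tree N" for p
    proof -
      have "{\<pi> \<in> J. ?\<sigma> \<pi> = p} = (if p \<in> C then {g p} else {})"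
        using g(2) by (auto simp: J_def)
      then have "card {\<pi> \<in> J. ?\<sigma> \<pi> = p} = of_bool (contained_in p m)"
        using p by (simp add: C_def)
      then show ?thesis using finJ by (simp add: I_eq fiber_size_def)
    qed
    \<comment> \<open>By \<open>sum_covers_below\<close>, removing \<open>J\<close> lowers both
      sides of the identity equally.\<close>
    have "fiber_size N I' p = (\<Sum>q | covers N q p. fiber_size N I' q)"
      if p: "p \<in> prefix_tree N" "\<not> maximal_prefix N p" for p
    proof -
      have "(\<Sum>q | covers N q p. fiber_size N I q)
          = (\<Sum>q | covers N q p. fiber_size N I' q + of_bool (contained_in q m))"
        using fiber by (intro sum.cong) (auto simp: covers_def)
      then show ?thesis
        using less.prems(2)[OF p] fiber[OF p(1)] sum_covers_below[OF p max]
        by (simp add: sum.distrib)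
    qed
    moreover have "set_mset I' \<subseteq> perms N"
      using less.prems(1) unfolding I_eq by auto
    ultimately have "has_maximal_chain_partition N I'" using less.hyps[OF smaller] by blast
    then obtain Js where Js: "\<forall>J\<in>set Js. maximal_saturated_chain N J"
      "\<And>\<pi>. \<pi> \<in> perms N \<Longrightarrow> card {j. j < length Js \<and> \<pi> \<in> Js ! j} = count I' \<pi>"
      by (auto simp: has_maximal_chain_partition_def)
    have "bij_betw ?\<sigma> J C"
      using g(2) unfolding J_def by (intro bij_betw_byWitness[where f' = g]) auto
    then have "maximal_saturated_chain N J"
      using maximal_chain_below[OF max] g(1) less.prems(1)
      unfolding maximal_saturated_chain_def J_def C_def[symmetric] by blast
    \<comment> \<open>Reading the number of indices as the length of a filtered list, prepending
      \<open>J\<close> adds one exactly when \<open>\<pi>\<close> belongs to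
      \<open>J\<close>.\<close>
    moreover have "card {j. j < length (J # Js) \<and> \<pi> \<in> (J # Js) ! j} = count I \<pi>"
      if "\<pi> \<in> perms N" for \<pi>
      using Js(2)[OF that] finJ unfolding length_filter_conv_card[symmetric, where p = "(\<in>) \<pi>"]
      by (simp add: I_eq count_mset_set')
    ultimately show ?thesis
      unfolding has_maximal_chain_partition_def using Js(1)
      by (intro exI[of _ "J # Js"]) auto
  qed
qed

theorem theorem2p3:
  fixes N :: nat and I :: "nat list multiset"
  assumes "N \<ge> 1"
    and "I \<noteq> {#}"
    and "set_mset I \<subseteq> perms N"
  shows "(strategy_indifferent N I \<longleftrightarrow> has_maximal_chain_partition N I) \<and>
    (has_maximal_chain_partition N I \<longleftrightarrow>
      (\<forall>p\<in>prefix_tree N. \<not> maximal_prefix N p \<longrightarrow>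
        fiber_size N I p = (\<Sum>q | covers N q p. fiber_size N I q)))"
  using chain_partition_imp_strategy_indifferent[OF assms]
    strategy_indifferent_imp_cover_sum[OF assms] cover_sum_imp_chain_partition[OF assms(1,3)]
  by blast

end
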